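(* Let $m\ge2$ and, for real $\alpha_1,\ldots,\alpha_m>0$, let $$T(\alpha_1,\ldots,\alpha_m):=\lim_{n\to\infty}\tau_1(\alpha_1n,\ldots,\alpha_mn),$$ where $\tau_1$ is the probability of player 1 being last, as defined in the context. If $m\ge3$, then $T$ is strictly increasing in each $\alpha_\ell$, $2\le\ell\le m$. If $m=2$, then $T$ is constant equal to $\frac12$.
   Context: For real $x_1,\ldots,x_m>0$, $$\tau_1(x_1,\ldots,x_m)=\mathbb{P}\left(\frac{G_2}{x_2}\le\frac{G_1}{x_1},\ldots,\frac{G_m}{x_m}\le\frac{G_1}{x_1}\right),$$ where $G_1,\ldots,G_m$ are independent and $G_j\sim\operatorname{Gamma}(x_j,1)$, i.e. $G_j$ has density $x^{x_j-1}e^{-x}/\Gamma(x_j)$ on $(0,\infty)$. For positive integer arguments this is the probability that player 1 is the last to reach their goal in the game in which in each round exactly one player advances one step, player $\ell$ with probability $x_\ell/(x_1+\cdots+x_m)$, and the goal of player $\ell$ is $x_\ell$ steps. The limit $T$ exists and equals $$\int_{-\infty}^\infty\prod_{k=2}^m\Phi\Big(\sqrt{\tfrac{\alpha_k}{\alpha_1}}\,z\Big)\frac{1}{\sqrt{2\pi}}e^{-z^2/2}\,dz,$$ with $\Phi$ the standard normal cumulative distribution function; $n$ runs through $\mathbb{N}_{\ge1}$. *)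

theory Defs
  imports "HOL-Probability.Probability"
begin

definition gamma_density :: "real \<Rightarrow> real \<Rightarrow> real" where
  "gamma_density a x = (if x > 0 then x powr (a - 1) * exp (- x) / Gamma a else 0)"

definition gamma_measure :: "real \<Rightarrow> real measure" where
  "gamma_measure a = density lborel (\<lambda>x. ennreal (gamma_density a x))"

text \<open>
  The variables \<open>G\<^sub>1, \<dots>, G\<^sub>m\<close> are realised as the coordinates of the product space. Only the
  values of \<open>x\<close> on \<open>{1..m}\<close> matter, and they are meant to be positive.
\<close>

definition tau1 :: "nat \<Rightarrow> (nat \<Rightarrow> real) \<Rightarrow> real" where
  "tau1 m x =
     (let P = PiM {1..m} (\<lambda>j. gamma_measure (x j))
      in measure P {G \<in> space P. \<forall>k\<in>{2..m}. G k / x k \<le> G 1 / x 1})"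

text \<open>The term for \<open>n = 0\<close> is meaningless but does not affect the limit.\<close>

definition T :: "nat \<Rightarrow> (nat \<Rightarrow> real) \<Rightarrow> real" where
  "T m \<alpha> = lim (\<lambda>n. tau1 m (\<lambda>j. \<alpha> j * real n))"

lemma sets_gamma_measure [measurable_cong, simp]: "sets (gamma_measure a) = sets borel"
  by (simp add: gamma_measure_def)

lemma space_gamma_measure [simp]: "space (gamma_measure a) = UNIV"
  by (simp add: gamma_measure_def)

lemma gamma_density_measurable [measurable]: "gamma_density a \<in> borel_measurable borel"
  unfolding gamma_density_def[abs_def] by measurable

lemma prob_space_gamma_measure:
  assumes "a > 0"
  shows "prob_space (gamma_measure a)"
proof
  have G: "Gamma a > 0"
    using assms by (rule Gamma_real_pos)
  have "emeasure (gamma_measure a) (space (gamma_measure a)) =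
      (\<integral>\<^sup>+x. ennreal (gamma_density a x) \<partial>lborel)"
    by (simp add: gamma_measure_def emeasure_density)
  also have "\<dots> = (\<integral>\<^sup>+x. ennreal (1 / Gamma a) *
      ennreal (indicator {0..} x * x powr (a - 1) / exp x) \<partial>lborel)"
    by (intro nn_integral_cong_AE eventually_mono[OF AE_lborel_singleton[of 0]])
       (use G in \<open>auto simp: gamma_density_def exp_minus field_simps indicator_def
          simp flip: ennreal_mult\<close>)
  also have "\<dots> = ennreal (1 / Gamma a) * ennreal (Gamma a)"
    by (subst nn_integral_cmult) (auto simp: Gamma_conv_nn_integral_real[OF assms])
  also have "\<dots> = 1"
    using G by (simp flip: ennreal_mult)
  finally show "emeasure (gamma_measure a) (space (gamma_measure a)) = 1" .
qed

lemma (in prob_space) tau1_eq_prob: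
  fixes G :: "nat \<Rightarrow> 'a \<Rightarrow> real"
  assumes m: "m \<ge> 1"
    and indep: "indep_vars (\<lambda>_. borel) G {1..m}"
    and distr: "\<And>j. j \<in> {1..m} \<Longrightarrow> distributed M lborel (G j) (gamma_density (x j))"
  shows "tau1 m x = prob {\<omega> \<in> space M. \<forall>k\<in>{2..m}. G k \<omega> / x k \<le> G 1 \<omega> / x 1}"
proof -
  have rv [measurable]: "G j \<in> borel_measurable M" if "j \<in> {1..m}" for j
    using distributed_measurable[OF distr[OF that]] by simp
  have rv1 [measurable]: "G 1 \<in> borel_measurable M"
    using m by (intro rv) auto
  have "distr M (\<Pi>\<^sub>M i\<in>{1..m}. borel) (\<lambda>\<omega>. \<lambda>i\<in>{1..m}. G i \<omega>) = PiM {1..m} (\<lambda>i. distr M borel (G i))"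
    using indep m rv by (subst (asm) indep_vars_iff_distr_eq_PiM') auto
  also have "\<dots> = PiM {1..m} (\<lambda>j. gamma_measure (x j))"
  proof (intro PiM_cong refl)
    fix j assume "j \<in> {1..m}"
    have "distr M borel (G j) = distr M lborel (G j)"
      by (intro distr_cong) auto
    then show "distr M borel (G j) = gamma_measure (x j)"
      using distributed_distr_eq_density[OF distr[OF \<open>j \<in> {1..m}\<close>]] by (simp add: gamma_measure_def)
  qed
  finally have eq: "PiM {1..m} (\<lambda>j. gamma_measure (x j)) =
      distr M (\<Pi>\<^sub>M i\<in>{1..m}. borel) (\<lambda>\<omega>. \<lambda>i\<in>{1..m}. G i \<omega>)" ..
  have meas: "(\<lambda>\<omega>. \<lambda>i\<in>{1..m}. G i \<omega>) \<in> measurable M (\<Pi>\<^sub>M i\<in>{1..m}. borel)"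
    by (intro measurable_restrict rv)
  have [measurable]: "(\<lambda>g. g k) \<in> borel_measurable (\<Pi>\<^sub>M i\<in>{1..m}. borel :: real measure)"
    if "k \<in> {1..m}" for k
    using that by (rule measurable_component_singleton)
  have "{g \<in> space (\<Pi>\<^sub>M i\<in>{1..m}. borel). \<forall>k\<in>{2..m}. g k / x k \<le> g 1 / x 1}
      \<in> sets (\<Pi>\<^sub>M i\<in>{1..m}. borel :: real measure)"
    using m by (intro sets.sets_Collect_finite_All borel_measurable_le) auto
  with meas show ?thesis
    unfolding tau1_def Let_def eq
    by (subst measure_distr)
       (use m in \<open>auto simp: space_PiM PiE_iff intro!: arg_cong[where f = "measure M"]\<close>)
qed

end

theory Submission
  imports Defs "HOL-Real_Asymp.Real_Asymp"
begin

text \<open>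
  For \<open>G \<sim> Gamma(\<alpha>n, 1)\<close> the variable \<open>V = \<surd>n \<sqdot> log (G / (\<alpha>n))\<close> has a density proportional to
  \<open>exp (-\<alpha>n \<phi>(v / \<surd>n))\<close>, where \<open>\<phi> w = e\<^sup>w - 1 - w\<close>, and the event defining \<open>\<tau>\<^sub>1\<close> becomes
  \<open>V\<^sub>k \<le> V\<^sub>1\<close> for all \<open>k\<close>. These densities converge to those of \<open>N(0, 1/\<alpha>)\<close> and are dominated by
  \<open>exp (-\<alpha> (\<bar>v\<bar> - 1) / 2)\<close>; integrating them also yields the normalising constant, so
  Stirling's formula is not needed.

  For the monotonicity, let \<open>D\<close> be the difference of the distribution functions of \<open>N(0, 1/b)\<close> and
  \<open>N(0, 1/a)\<close> with \<open>a < b\<close>, let \<open>A\<close> be the product of the other distribution functions and \<open>g\<close> the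
  density of \<open>V\<^sub>1\<close>. Since \<open>D\<close> is odd and \<open>g\<close> even, \<open>2 \<integral> D A g\<close> is the integral of
  \<open>D(v) (A(v) - A(-v)) g(v)\<close>, which is positive for \<open>v \<noteq> 0\<close> as \<open>A\<close> is strictly increasing.
\<close>

section \<open>Exponential remainder\<close>

text \<open>Convexity: \<open>exp\<close> lies above its tangents at \<open>1 / N\<close> and
  \<open>-1 / N\<close>; for \<open>\<bar>v\<bar> \<le> 1\<close> the right-hand side is not
  positive. The bound is free of \<open>N\<close>, so it yields one integrable majorant for all
  \<open>n\<close>.\<close>

lemma exp_remainder_ge:
  fixes v N :: real
  assumes N: "N \<ge> 1"
  shows "N\<^sup>2 * (exp (v / N) - 1 - v / N) \<ge> (\<bar>v\<bar> - 1) / 2"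
proof -
  have tangent: "exp (v / N) \<ge> exp (c / N) * (1 + (v - c) / N)" for c
  proof -
    have "exp (c / N) * (1 + (v - c) / N) \<le> exp (c / N) * exp ((v - c) / N)"
      by (intro mult_left_mono exp_ge_add_one_self) auto
    also have "\<dots> = exp (v / N)" using N by (simp flip: exp_add add: field_simps)
    finally show ?thesis .
  qed
  have "exp (v / N) - 1 - v / N \<ge> 0"
    using exp_ge_add_one_self[of "v/N"] by linarith
  then have pos: "N\<^sup>2 * (exp (v / N) - 1 - v / N) \<ge> 0"
    by (intro mult_nonneg_nonneg) auto
  consider "\<bar>v\<bar> \<le> 1" | "v > 1" | "v < -1" by linarith
  then show ?thesis
  proof cases
    case 1 then show ?thesis using pos by (smt (verit) divide_nonpos_pos)
  next
    case 2
    have "exp (1 / N) * (1 + (v - 1) / N) \<ge> (1 + 1 / N) * (1 + (v - 1) / N)"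
      using 2 N by (intro mult_right_mono exp_ge_add_one_self) auto
    with tangent[of 1] have "exp (v/N) - 1 - v/N \<ge> (1 + 1 / N) * (1 + (v - 1) / N) - 1 - v / N"
      by linarith
    also have "(1 + 1 / N) * (1 + (v - 1) / N) - 1 - v / N = (v - 1) / N\<^sup>2"
      using N by (simp add: field_simps power2_eq_square)
    finally have "N\<^sup>2 * ((v - 1) / N\<^sup>2) \<le> N\<^sup>2 * (exp (v / N) - 1 - v / N)"
      by (intro mult_left_mono) auto
    then have "v - 1 \<le> N\<^sup>2 * (exp (v / N) - 1 - v / N)" using N by simp
    moreover have "(\<bar>v\<bar> - 1) / 2 \<le> v - 1" using 2 by simp
    ultimately show ?thesis by linarith
  next
    \<comment> \<open>The tangent at \<open>-1 / N\<close> leaves the slope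
      \<open>(1 - e) / N\<close> with \<open>1 - e \<ge> 1 / (N + 1) \<ge> 1 / (2 * N)\<close>. The
      last inequality uses \<open>N \<ge> 1\<close> and is the source of the factor 1/2.\<close>
    case 3
    define e where "e = exp (-1 / N)"
    have "exp (1/N) \<ge> 1 + 1 / N" by (rule exp_ge_add_one_self)
    then have e1: "e \<le> N / (N + 1)" using N unfolding e_def by (simp add: exp_minus field_simps)
    have e0: "e \<ge> 1 - 1 / N" using exp_ge_add_one_self[of "-1/N"] by (simp add: e_def)
    have "exp (v/N) - 1 - v/N \<ge> e * (1 + (v + 1) / N) - 1 - v / N"
      using tangent[of "-1"] by (simp add: e_def)
    also have "e * (1 + (v + 1) / N) - 1 - v / N = e - 1 + 1 / N + (1 - e) * ((- v - 1) / N)"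
      using N by (simp add: field_simps)
    finally have a: "exp (v/N) - 1 - v/N \<ge> (1 - e) * ((- v - 1) / N)" using e0 by linarith
    have "1 / (2 * N) \<le> 1 - N / (N + 1)" using N by (simp add: field_simps)
    then have "1 / (2 * N) \<le> 1 - e" using e1 by linarith
    then have "1 / (2 * N) * ((- v - 1) / N) \<le> (1 - e) * ((- v - 1) / N)"
      using 3 N by (intro mult_right_mono) auto
    with a have "N\<^sup>2 * (1 / (2 * N) * ((- v - 1) / N)) \<le> N\<^sup>2 * (exp (v / N) - 1 - v / N)"
      by (intro mult_left_mono) auto
    then show ?thesis using 3 N by (simp add: power2_eq_square)
  qed
qed

lemma exp_remainder_tendsto:
  fixes v :: real
  shows "(\<lambda>n. real n * (exp (v / sqrt (real n)) - 1 - v / sqrt (real n))) \<longlonglongrightarrow> v\<^sup>2 / 2"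
proof (cases "v = 0")
  case False
  \<comment> \<open>The expansion is done for each sign of \<open>v\<close>, which decides the side
    from which \<open>v / sqrt (real n)\<close> approaches 0.\<close>
  then have "v < 0 \<or> v > 0" by linarith
  then show ?thesis
    unfolding power2_eq_square by (elim disjE) real_asymp+
qed simp

text \<open>The integrand is a one-sided exponential plus its mirror image, except at 0, where both
  indicators vanish.\<close>

lemma integrable_exp_neg_abs:
  fixes b :: real
  assumes "b > 0"
  shows "integrable lborel (\<lambda>v. exp (- (b * \<bar>v\<bar>)))"
proof -
  define f where "f = (\<lambda>v::real. indicator {0<..} v *\<^sub>R exp (- (v * b)))"
  have f: "integrable lborel f"
    using integrable_I0i_exp_mscale[OF assms] by (simp add: set_integrable_def f_def)
  have "integrable lborel (\<lambda>v. f v + f (0 + (-1) * v))"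
    by (intro Bochner_Integration.integrable_add f lborel_integrable_real_affine) auto
  then show ?thesis
    by (rule integrable_cong_AE_imp)
       (use AE_lborel_singleton[of 0] in \<open>auto simp: f_def indicator_def mult.commute elim!: eventually_mono\<close>)
qed

section \<open>Centred normal distributions\<close>

text \<open>\<open>\<alpha>\<close> is the precision, so the factor in the shape
  \<open>\<alpha> * n\<close> of the Gamma law becomes the parameter of the limit.\<close>

abbreviation gauss :: "real \<Rightarrow> real \<Rightarrow> real" where
  "gauss \<alpha> \<equiv> normal_density 0 (1 / sqrt \<alpha>)"

lemma gauss_eq:
  assumes "\<alpha> > 0"
  shows "gauss \<alpha> v = sqrt (\<alpha> / (2 * pi)) * exp (- (\<alpha> * (v\<^sup>2 / 2)))"
proof -
  have "1 / sqrt (2 * pi * (1 / \<alpha>)) = sqrt (\<alpha> / (2 * pi))"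
    by (simp add: real_sqrt_divide)
  moreover have "- v\<^sup>2 / (2 * (1 / \<alpha>)) = - (\<alpha> * (v\<^sup>2 / 2))"
    by simp
  moreover have "(1 / sqrt \<alpha>)\<^sup>2 = 1 / \<alpha>"
    using assms by (simp add: power_divide)
  ultimately show ?thesis
    by (simp only: normal_density_def diff_0_right)
qed

text \<open>In terms of the standard normal distribution function Phi this is Phi at
  \<open>sqrt \<alpha> * u\<close>. An integral of an indicator is the form in which the limits
  below arise.\<close>

definition gauss_cdf :: "real \<Rightarrow> real \<Rightarrow> real" where
  "gauss_cdf \<alpha> u = (\<integral>v. indicator {..u} v * gauss \<alpha> v \<partial>lborel)"

text \<open>A zero integral would force \<open>f = 0\<close> almost everywhere and make
  \<open>S\<close> a null set. Positivity is asked only almost everywhere because the symmetrised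
  integrand of the monotonicity argument vanishes at 0.\<close>

lemma integral_lborel_pos:
  fixes f :: "real \<Rightarrow> real"
  assumes int: "integrable lborel f" and nn: "AE v in lborel. f v \<ge> 0"
    and S: "S \<in> sets lborel" "emeasure lborel S \<noteq> 0" and pos: "AE v in lborel. v \<in> S \<longrightarrow> f v > 0"
  shows "(\<integral>v. f v \<partial>lborel) > 0"
proof -
  have "\<not> (AE v in lborel. f v = 0)"
  proof
    assume "AE v in lborel. f v = 0"
    with pos have "AE v in lborel. v \<notin> S" by eventually_elim auto
    with S show False by (simp add: AE_iff_null_sets[OF S(1), symmetric] null_setsI null_sets_def)
  qed
  then have "(\<integral>v. f v \<partial>lborel) \<noteq> 0"
    using integral_nonneg_eq_0_iff_AE[OF int nn] by simp
  with integral_nonneg_AE[OF nn] show ?thesis by simp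
qed

lemma integral_symmetrize:
  fixes f :: "real \<Rightarrow> real"
  assumes int: "integrable lborel f"
  shows "integrable lborel (\<lambda>v. f v + f (- v))"
    and "(\<integral>v. f v + f (- v) \<partial>lborel) = 2 * (\<integral>v. f v \<partial>lborel)"
proof -
  have int': "integrable lborel (\<lambda>v. f (- v))"
    using lborel_integrable_real_affine[OF int, of "-1" 0] by simp
  show "integrable lborel (\<lambda>v. f v + f (- v))"
    by (intro Bochner_Integration.integrable_add int int')
  have "(\<integral>v. f (- v) \<partial>lborel) = (\<integral>v. f v \<partial>lborel)"
    using lborel_integral_real_affine[of "-1" f 0] by simp
  then show "(\<integral>v. f v + f (- v) \<partial>lborel) = 2 * (\<integral>v. f v \<partial>lborel)"
    by (simp add: Bochner_Integration.integral_add[OF int int'])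
qed

lemma gauss_minus: "gauss \<alpha> (- v) = gauss \<alpha> v"
  by (simp add: normal_density_def)

lemma gauss_cdf_integrable:
  assumes "\<alpha> > 0"
  shows "integrable lborel (\<lambda>v. indicator {..u} v * gauss \<alpha> v)"
  using integrable_real_mult_indicator[of "{..u}" lborel "gauss \<alpha>"] assms
  by (simp add: mult.commute)

lemma gauss_cdf_strict_mono:
  assumes \<alpha>: "\<alpha> > 0" and "u < w"
  shows "gauss_cdf \<alpha> u < gauss_cdf \<alpha> w"
proof -
  have "0 < (\<integral>v. indicator {..w} v * gauss \<alpha> v - indicator {..u} v * gauss \<alpha> v \<partial>lborel)"
  proof (rule integral_lborel_pos[where S = "{u<..w}"])
    show "emeasure lborel {u<..w} \<noteq> 0" using \<open>u < w\<close> by simp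
    show "AE v in lborel. v \<in> {u<..w} \<longrightarrow>
        0 < indicator {..w} v * gauss \<alpha> v - indicator {..u} v * gauss \<alpha> v"
      using \<alpha> normal_density_pos[of "1 / sqrt \<alpha>" 0] by (auto simp: indicator_def)
    show "AE v in lborel. 0 \<le> indicator {..w} v * gauss \<alpha> v - indicator {..u} v * gauss \<alpha> v"
      using \<open>u < w\<close> by (auto simp: indicator_def)
  qed (use \<alpha> gauss_cdf_integrable in \<open>auto intro!: Bochner_Integration.integrable_diff\<close>)
  also have "\<dots> = gauss_cdf \<alpha> w - gauss_cdf \<alpha> u"
    unfolding gauss_cdf_def by (intro Bochner_Integration.integral_diff gauss_cdf_integrable \<alpha>)
  finally show ?thesis by simp
qed

lemma gauss_cdf_measurable:
  assumes "\<alpha> > 0"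
  shows "gauss_cdf \<alpha> \<in> borel_measurable borel"
  using gauss_cdf_strict_mono[OF assms] by (intro borel_measurable_mono strict_mono_mono strict_monoI)

lemma gauss_cdf_minus:
  assumes \<alpha>: "\<alpha> > 0"
  shows "gauss_cdf \<alpha> (- u) = 1 - gauss_cdf \<alpha> u"
proof -
  let ?f = "\<lambda>v. indicator {..-u} v * gauss \<alpha> v"
  have int: "integrable lborel (\<lambda>v. ?f (- v))"
    using lborel_integrable_real_affine[OF gauss_cdf_integrable[OF \<alpha>, of "-u"], of "-1" 0] by simp
  have "gauss_cdf \<alpha> (- u) = (\<integral>v. ?f (- v) \<partial>lborel)"
    using lborel_integral_real_affine[of "-1" ?f 0] by (simp add: gauss_cdf_def)
  then have "gauss_cdf \<alpha> (- u) + gauss_cdf \<alpha> u = (\<integral>v. ?f (- v) + indicator {..u} v * gauss \<alpha> v \<partial>lborel)"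
    unfolding gauss_cdf_def by (simp add: Bochner_Integration.integral_add[OF int gauss_cdf_integrable[OF \<alpha>]])
  \<comment> \<open>At \<open>v = u\<close> both indicators are 1, so the integrands agree only off
    this point.\<close>
  also have "\<dots> = (\<integral>v. gauss \<alpha> v \<partial>lborel)"
    by (intro integral_cong_AE eventually_mono[OF AE_lborel_singleton[of u]])
       (auto simp: indicator_def gauss_minus)
  also have "\<dots> = 1" using \<alpha> by simp
  finally show ?thesis by simp
qed

lemma gauss_cdf_pos:
  assumes "\<alpha> > 0"
  shows "gauss_cdf \<alpha> u > 0"
proof -
  have "0 \<le> gauss_cdf \<alpha> (u - 1)" unfolding gauss_cdf_def by (intro Bochner_Integration.integral_nonneg) simp
  also have "\<dots> < gauss_cdf \<alpha> u" using assms by (intro gauss_cdf_strict_mono) auto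
  finally show ?thesis .
qed

lemma gauss_cdf_less_1:
  assumes "\<alpha> > 0"
  shows "gauss_cdf \<alpha> u < 1"
  using gauss_cdf_pos[OF assms, of "-u"] gauss_cdf_minus[OF assms, of u] by simp

text \<open>Substitution of \<open>v / sqrt \<alpha>\<close>. The precision becomes a scaling of the
  argument, which makes distribution functions with different precisions comparable.\<close>

lemma gauss_cdf_scale:
  assumes \<alpha>: "\<alpha> > 0"
  shows "gauss_cdf \<alpha> u = gauss_cdf 1 (sqrt \<alpha> * u)"
proof -
  let ?f = "\<lambda>v. indicator {..u} v * gauss \<alpha> v"
  have "gauss_cdf \<alpha> u = \<bar>1 / sqrt \<alpha>\<bar> *\<^sub>R (\<integral>v. ?f (0 + 1 / sqrt \<alpha> * v) \<partial>lborel)"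
    unfolding gauss_cdf_def using \<alpha> by (intro lborel_integral_real_affine) auto
  also have "\<dots> = (\<integral>v. \<bar>1 / sqrt \<alpha>\<bar> * ?f (0 + 1 / sqrt \<alpha> * v) \<partial>lborel)"
    by simp
  also have "\<dots> = gauss_cdf 1 (sqrt \<alpha> * u)"
    unfolding gauss_cdf_def
  proof (intro Bochner_Integration.integral_cong refl)
    fix v
    have "\<bar>1 / sqrt \<alpha>\<bar> * gauss \<alpha> (0 + 1 / sqrt \<alpha> * v) = gauss 1 v"
      using \<alpha> by (simp add: normal_density_def power_divide real_sqrt_divide)
    moreover have "indicator {..u} (0 + 1 / sqrt \<alpha> * v) = (indicator {..sqrt \<alpha> * u} v :: real)"
      using \<alpha> by (simp add: indicator_def field_simps)
    ultimately show "\<bar>1 / sqrt \<alpha>\<bar> * ?f (0 + 1 / sqrt \<alpha> * v) = indicator {..sqrt \<alpha> * u} v * gauss 1 v"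
      by (metis mult.left_commute)
  qed
  finally show ?thesis .
qed

section \<open>Integrals of products of normal distribution functions\<close>

lemma gauss_cdf_prod_integrable:
  assumes \<alpha>: "\<alpha> > 0" and "\<And>k. k \<in> K \<Longrightarrow> \<beta> k > 0"
  shows "integrable lborel (\<lambda>v. (\<Prod>k\<in>K. gauss_cdf (\<beta> k) v) * gauss \<alpha> v)"
proof (rule Bochner_Integration.integrable_bound)
  show "integrable lborel (gauss \<alpha>)" using \<alpha> by simp
  have "\<bar>\<Prod>k\<in>K. gauss_cdf (\<beta> k) v\<bar> \<le> 1" for v
    unfolding abs_prod using assms(2) gauss_cdf_pos gauss_cdf_less_1
    by (intro prod_le_1) (simp add: less_imp_le)
  then have "\<bar>\<Prod>k\<in>K. gauss_cdf (\<beta> k) v\<bar> * gauss \<alpha> v \<le> 1 * gauss \<alpha> v" for v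
    by (intro mult_right_mono) auto
  then show "AE v in lborel. norm ((\<Prod>k\<in>K. gauss_cdf (\<beta> k) v) * gauss \<alpha> v) \<le> norm (gauss \<alpha> v)"
    by (simp add: abs_mult)
  show "(\<lambda>v. (\<Prod>k\<in>K. gauss_cdf (\<beta> k) v) * gauss \<alpha> v) \<in> borel_measurable lborel"
    using assms(2) by (intro borel_measurable_times borel_measurable_prod) (auto simp: gauss_cdf_measurable)
qed

text \<open>\<open>K \<noteq> {}\<close> makes the product strictly increasing, by one strict factor
  among positive ones. With an empty product the symmetrised difference would vanish and both
  integrals would be 1/2.\<close>

lemma gauss_cdf_product_integral_strict_mono:
  assumes K: "finite K" "K \<noteq> {}" and \<alpha>: "\<alpha> > 0" and \<beta>: "\<And>k. k \<in> K \<Longrightarrow> \<beta> k > 0"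
    and ab: "0 < a" "a < b"
  shows "(\<integral>v. gauss_cdf a v * (\<Prod>k\<in>K. gauss_cdf (\<beta> k) v) * gauss \<alpha> v \<partial>lborel) <
    (\<integral>v. gauss_cdf b v * (\<Prod>k\<in>K. gauss_cdf (\<beta> k) v) * gauss \<alpha> v \<partial>lborel)"
    (is "integral\<^sup>L lborel (?f a) < integral\<^sup>L lborel (?f b)")
proof -
  let ?A = "\<lambda>v. \<Prod>k\<in>K. gauss_cdf (\<beta> k) v"
  let ?D = "\<lambda>v. gauss_cdf b v - gauss_cdf a v"
  have b: "b > 0" using ab by simp
  have int: "integrable lborel (?f c)" if "c > 0" for c
  proof -
    \<comment> \<open>\<open>None\<close> is a fresh index for the extra factor with parameter
      \<open>c\<close>, since the index type of \<open>K\<close> may have no spare element.\<close>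
    have "integrable lborel (\<lambda>v. (\<Prod>x\<in>insert None (Some ` K).
        gauss_cdf (case x of None \<Rightarrow> c | Some k \<Rightarrow> \<beta> k) v) * gauss \<alpha> v)"
      by (rule gauss_cdf_prod_integrable) (use \<alpha> \<beta> that in auto)
    then show ?thesis using K by (simp add: prod.reindex)
  qed
  let ?d = "\<lambda>v. ?f b v - ?f a v"
  have intd: "integrable lborel ?d" by (intro Bochner_Integration.integrable_diff int b ab)
  have A: "?A u < ?A w" if "u < w" for u w
  proof -
    obtain k where "k \<in> K" using K by blast
    then show ?thesis
      using K \<beta> by (intro prod_mono_strict[of k])
        (auto intro: gauss_cdf_strict_mono that gauss_cdf_pos less_imp_le)
  qed
  \<comment> \<open>After rescaling, both terms are values of the standard distribution function, at
    \<open>sqrt b * v\<close> and at the smaller \<open>sqrt a * v\<close>.\<close>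
  have D: "?D v > 0" if "v > 0" for v
  proof -
    have "sqrt a * v < sqrt b * v" using that ab by simp
    then show ?thesis
      using gauss_cdf_strict_mono[of 1] by (simp add: gauss_cdf_scale[OF b] gauss_cdf_scale[OF ab(1)])
  qed
  have D_minus: "?D (- v) = - ?D v" for v using ab by (simp add: gauss_cdf_minus)
  have sym: "?d v + ?d (- v) = ?D v * (?A v - ?A (- v)) * gauss \<alpha> v" for v
  proof -
    have "?d v + ?d (- v) = (?D v * ?A v + ?D (- v) * ?A (- v)) * gauss \<alpha> v"
      by (simp add: gauss_minus algebra_simps)
    then show ?thesis unfolding D_minus by (simp add: algebra_simps)
  qed
  have pos: "?d v + ?d (- v) > 0" if "v \<noteq> 0" for v
  proof (cases "v > 0")
    case True
    then show ?thesis unfolding sym using \<alpha> A[of "-v" v] D[of v]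
      by (intro mult_pos_pos normal_density_pos) auto
  next
    case False
    \<comment> \<open>For \<open>v < 0\<close> both \<open>?D v\<close> and the difference of the
      products are negative, so their product is again positive.\<close>
    with that have "?D v < 0" "?A v < ?A (- v)" using D[of "-v"] A[of v "-v"] D_minus[of v] by auto
    then show ?thesis unfolding sym using \<alpha>
      by (intro mult_pos_pos[OF mult_neg_neg] normal_density_pos) auto
  qed
  have "0 < (\<integral>v. ?d v + ?d (- v) \<partial>lborel)"
  proof (rule integral_lborel_pos[where S = UNIV])
    show "integrable lborel (\<lambda>v. ?d v + ?d (- v))" by (rule integral_symmetrize(1)[OF intd])
    show "AE v in lborel. 0 \<le> ?d v + ?d (- v)"
      using AE_lborel_singleton[of 0] by eventually_elim (rule less_imp_le[OF pos])
    show "AE v in lborel. v \<in> UNIV \<longrightarrow> 0 < ?d v + ?d (- v)"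
      using AE_lborel_singleton[of 0] by eventually_elim (use pos in blast)
  qed auto
  then have "0 < (\<integral>v. ?d v \<partial>lborel)"
    unfolding integral_symmetrize(2)[OF intd] by simp
  also have "\<dots> = integral\<^sup>L lborel (?f b) - integral\<^sup>L lborel (?f a)"
    by (intro Bochner_Integration.integral_diff int b ab)
  finally show ?thesis by simp
qed

text \<open>By \<open>gauss_cdf_minus\<close> the integrand and its reflection add up to the density
  \<open>gauss \<alpha>\<close>. This is the case of two players.\<close>

lemma gauss_cdf_integral_half:
  assumes \<alpha>: "\<alpha> > 0" and \<beta>: "\<beta> > 0"
  shows "(\<integral>v. gauss_cdf \<beta> v * gauss \<alpha> v \<partial>lborel) = 1 / 2"
proof -
  let ?f = "\<lambda>v. gauss_cdf \<beta> v * gauss \<alpha> v"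
  have int: "integrable lborel ?f"
    using gauss_cdf_prod_integrable[of \<alpha> "{()}" "\<lambda>_. \<beta>"] \<alpha> \<beta> by simp
  have "2 * (\<integral>v. ?f v \<partial>lborel) = (\<integral>v. ?f v + ?f (- v) \<partial>lborel)"
    by (rule integral_symmetrize(2)[OF int, symmetric])
  also have "\<dots> = (\<integral>v. gauss \<alpha> v \<partial>lborel)"
    using \<beta> by (simp add: gauss_cdf_minus gauss_minus algebra_simps)
  also have "\<dots> = 1" using \<alpha> by simp
  finally show ?thesis by simp
qed

section \<open>Logarithms of Gamma variables\<close>

text \<open>The substitution \<open>x = a * exp (v / s)\<close>, later used with
  \<open>s = sqrt n\<close>. The exponent gets the form \<open>- a * (exp w - 1 - w)\<close> once
  \<open>exp (- a)\<close> has been moved into the constant.\<close>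

lemma gamma_measure_eq_distr_exp:
  fixes a s :: real
  assumes a: "a > 0" and s: "s > 0"
  shows "gamma_measure a =
    distr (density lborel (\<lambda>v. ennreal (a powr a * exp (- a) / (Gamma a * s) * exp (- a * (exp (v / s) - 1 - v / s)))))
      borel (\<lambda>v. a * exp (v / s))"
    (is "_ = distr (density lborel (\<lambda>v. ennreal (?C * ?h v))) borel ?g")
proof (rule measure_eqI)
  fix A assume "A \<in> sets (gamma_measure a)"
  then have A[measurable]: "A \<in> sets borel" by simp
  define f where "f x = indicator A x * gamma_density a x" for x :: real
  have G: "Gamma a > 0" using a by (rule Gamma_real_pos)
  have f0: "f x \<ge> 0" for x using G by (simp add: f_def gamma_density_def)
  have [measurable]: "f \<in> borel_measurable borel" unfolding f_def by measurable
  interpret prob_space "gamma_measure a" by (rule prob_space_gamma_measure) fact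
  have em: "emeasure (gamma_measure a) A = (\<integral>\<^sup>+x. ennreal (f x) \<partial>lborel)"
    unfolding gamma_measure_def f_def
    by (subst emeasure_density) (auto intro!: nn_integral_cong simp: indicator_def)
  have fint: "integrable lborel f"
    unfolding integrable_iff_bounded using emeasure_finite[of A] f0 em by (simp add: top.not_eq_extremum)
  have range: "range ?g = {0<..}"
  proof (intro equalityI subsetI)
    fix y :: real assume "y \<in> {0<..}"
    then have "y = ?g (s * ln (y / a))" using a s by simp
    then show "y \<in> range ?g" by (rule range_eqI)
  qed (use a in auto)
  have inj: "inj ?g" using a s by (intro injI) simp
  have der: "(?g has_field_derivative (a * exp (v / s) / s)) (at v within UNIV)" for v
    using s by (auto intro!: derivative_eq_intros)
  \<comment> \<open>The derivative of the substitution is \<open>x / s\<close>, which raises the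
    power \<open>a - 1\<close> in the Gamma density to \<open>a\<close>.\<close>
  have jac: "\<bar>a * exp (v / s) / s\<bar> * f (?g v) = indicator A (?g v) * (?C * ?h v)" for v
  proof -
    have "(a * exp (v / s)) * gamma_density a (?g v) = (a * exp (v / s)) powr a * exp (- ?g v) / Gamma a"
      using a by (simp add: gamma_density_def powr_diff)
    also have "\<dots> = a powr a * (exp (a * (v / s)) * exp (- ?g v)) / Gamma a"
      using a by (simp add: powr_mult powr_def[of "exp _"])
    also have "exp (a * (v / s)) * exp (- ?g v) = exp (- a) * ?h v"
      by (simp flip: exp_add add: algebra_simps)
    finally have eq: "(a * exp (v / s)) * gamma_density a (?g v) / s = ?C * ?h v"
      using s by simp
    have "\<bar>a * exp (v / s) / s\<bar> = a * exp (v / s) / s"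
      using a s by simp
    then have "\<bar>a * exp (v / s) / s\<bar> * f (?g v) =
        indicator A (?g v) * ((a * exp (v / s)) * gamma_density a (?g v) / s)"
      by (simp only: f_def times_divide_eq_left times_divide_eq_right mult_ac)
    then show ?thesis unfolding eq .
  qed
  have "f absolutely_integrable_on {0<..}"
  proof (rule set_integrable_subset)
    show "f absolutely_integrable_on UNIV"
      using fint by (simp add: set_integrable_def integrable_completion)
  qed auto
  then have "f absolutely_integrable_on range ?g \<and> integral (range ?g) f = integral {0<..} f"
    by (simp add: range)
  \<comment> \<open>The change of variables is an equivalence: it transfers integrability together
    with the value, so the new density requires no estimate of its own.\<close>
  moreover have "(UNIV :: real set) \<in> sets lebesgue" by simp
  note has_absolute_integral_change_of_variables_1'[OF this der inj, of f "integral {0<..} f", unfolded jac]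
  ultimately have cv: "(\<lambda>v. indicator A (?g v) * (?C * ?h v)) absolutely_integrable_on UNIV \<and>
      integral UNIV (\<lambda>v. indicator A (?g v) * (?C * ?h v)) = integral {0<..} f"
    by blast
  have nn: "indicator A (?g v) * (?C * ?h v) \<ge> 0" for v using G a s by auto
  have int2: "integrable lborel (\<lambda>v. indicator A (?g v) * (?C * ?h v))"
    using cv by (simp add: set_integrable_def integrable_completion)
  have "?g -` A \<in> sets borel"
    by (rule measurable_sets_borel[OF _ A]) measurable
  then have vim: "(\<integral>\<^sup>+v. ennreal (indicator A (?g v) * (?C * ?h v)) \<partial>lborel) =
      emeasure (density lborel (\<lambda>v. ennreal (?C * ?h v))) (?g -` A)"
    by (subst emeasure_density) (auto intro!: nn_integral_cong simp: indicator_def)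
  have "emeasure (gamma_measure a) A = ennreal (\<integral>x. f x \<partial>lborel)"
    unfolding em using fint f0 by (intro nn_integral_eq_integral) auto
  also have "(\<integral>x. f x \<partial>lborel) = integral UNIV f"
    using integral_lborel[OF fint] by simp
  also have "integral UNIV f = integral {0<..} f"
    by (rule integral_spike_set) (auto intro: negligible_subset[OF negligible_empty] simp: f_def gamma_density_def)
  also have "\<dots> = integral UNIV (\<lambda>v. indicator A (?g v) * (?C * ?h v))" by (rule cv[THEN conjunct2, symmetric])
  also have "\<dots> = (\<integral>v. indicator A (?g v) * (?C * ?h v) \<partial>lborel)"
    using integral_lborel[OF int2] by simp
  also have "ennreal \<dots> = (\<integral>\<^sup>+v. ennreal (indicator A (?g v) * (?C * ?h v)) \<partial>lborel)"
    using int2 nn by (subst nn_integral_eq_integral) auto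
  also note vim
  also have "emeasure (density lborel (\<lambda>v. ennreal (?C * ?h v))) (?g -` A) =
      emeasure (distr (density lborel (\<lambda>v. ennreal (?C * ?h v))) borel ?g) A"
    by (subst emeasure_distr) auto
  finally show "emeasure (gamma_measure a) A = \<dots>" .
qed simp

section \<open>Densities of the rescaled logarithms and their limits\<close>

text \<open>Unnormalised density of \<open>sqrt n * ln (G / (\<alpha> * n))\<close>. At
  \<open>n = 0\<close> it is constantly 1 and not integrable.\<close>

definition log_gamma_kernel :: "real \<Rightarrow> nat \<Rightarrow> real \<Rightarrow> real" where
  "log_gamma_kernel \<alpha> n v =
     exp (- (\<alpha> * (real n * (exp (v / sqrt (real n)) - 1 - v / sqrt (real n)))))"

text \<open>The constant of \<open>gamma_measure_eq_distr_exp\<close> for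
  \<open>a = \<alpha> * n\<close> and \<open>s = sqrt n\<close>. Its convergence amounts to
  Stirling's formula for \<open>Gamma (\<alpha> * n)\<close>.\<close>

definition log_gamma_const :: "real \<Rightarrow> nat \<Rightarrow> real" where
  "log_gamma_const \<alpha> n =
     (\<alpha> * real n) powr (\<alpha> * real n) * exp (- (\<alpha> * real n)) / (Gamma (\<alpha> * real n) * sqrt (real n))"

definition log_gamma_measure :: "real \<Rightarrow> nat \<Rightarrow> real measure" where
  "log_gamma_measure \<alpha> n =
     density lborel (\<lambda>v. ennreal (log_gamma_const \<alpha> n * log_gamma_kernel \<alpha> n v))"

lemma log_gamma_kernel_measurable [measurable]: "log_gamma_kernel \<alpha> n \<in> borel_measurable borel"
  unfolding log_gamma_kernel_def[abs_def] by measurable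

lemma log_gamma_kernel_pos: "log_gamma_kernel \<alpha> n v > 0"
  by (simp add: log_gamma_kernel_def)

lemma log_gamma_const_pos:
  assumes "\<alpha> > 0" "n > 0"
  shows "log_gamma_const \<alpha> n > 0"
  using assms by (simp add: log_gamma_const_def Gamma_real_pos)

text \<open>This is \<open>exp_remainder_ge\<close> with \<open>N = sqrt n\<close>, which is at
  least 1 as \<open>n > 0\<close>.\<close>

lemma log_gamma_kernel_le:
  assumes "\<alpha> > 0" "n > 0"
  shows "log_gamma_kernel \<alpha> n v \<le> exp (\<alpha> / 2) * exp (- (\<alpha> / 2 * \<bar>v\<bar>))"
proof -
  have "(\<bar>v\<bar> - 1) / 2 \<le> real n * (exp (v / sqrt (real n)) - 1 - v / sqrt (real n))"
    using exp_remainder_ge[of "sqrt (real n)" v] assms by simp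
  then have "\<alpha> * ((\<bar>v\<bar> - 1) / 2) \<le> \<alpha> * (real n * (exp (v / sqrt (real n)) - 1 - v / sqrt (real n)))"
    using assms by (intro mult_left_mono) auto
  also have "\<alpha> * ((\<bar>v\<bar> - 1) / 2) = \<alpha> / 2 * \<bar>v\<bar> - \<alpha> / 2"
    by (simp add: field_simps)
  finally show ?thesis
    unfolding log_gamma_kernel_def exp_add[symmetric] by (subst exp_le_cancel_iff) linarith
qed

lemma log_gamma_kernel_tendsto:
  "(\<lambda>n. log_gamma_kernel \<alpha> n v) \<longlonglongrightarrow> exp (- (\<alpha> * (v\<^sup>2 / 2)))"
  unfolding log_gamma_kernel_def by (intro tendsto_intros exp_remainder_tendsto)

lemma gamma_measure_eq_distr_log_gamma:
  assumes "\<alpha> > 0" "n > 0"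
  shows "gamma_measure (\<alpha> * real n) =
    distr (log_gamma_measure \<alpha> n) borel (\<lambda>v. \<alpha> * real n * exp (v / sqrt (real n)))"
proof -
  have "log_gamma_kernel \<alpha> n v = exp (- (\<alpha> * real n) * (exp (v / sqrt (real n)) - 1 - v / sqrt (real n)))" for v
    by (simp only: log_gamma_kernel_def mult.assoc mult_minus_left)
  moreover have "\<alpha> * real n > 0" "sqrt (real n) > 0" using assms by simp_all
  note gamma_measure_eq_distr_exp[OF this]
  ultimately show ?thesis
    by (simp only: log_gamma_measure_def log_gamma_const_def)
qed

lemma sets_log_gamma_measure [measurable_cong, simp]: "sets (log_gamma_measure \<alpha> n) = sets borel"
  by (simp add: log_gamma_measure_def)

lemma space_log_gamma_measure [simp]: "space (log_gamma_measure \<alpha> n) = UNIV"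
  by (simp add: log_gamma_measure_def)

text \<open>The image of this measure is a Gamma measure of mass 1, so the normalisation needs no
  computation.\<close>

lemma prob_space_log_gamma_measure:
  assumes "\<alpha> > 0" "n > 0"
  shows "prob_space (log_gamma_measure \<alpha> n)"
proof -
  have "prob_space (distr (log_gamma_measure \<alpha> n) borel (\<lambda>v. \<alpha> * real n * exp (v / sqrt (real n))))"
    using prob_space_gamma_measure[of "\<alpha> * real n"] assms
    by (simp add: gamma_measure_eq_distr_log_gamma)
  then show ?thesis by (rule prob_space_distrD[rotated]) measurable
qed

lemma integral_log_gamma_measure:
  fixes u :: "real \<Rightarrow> real"
  assumes "\<alpha> > 0" "n > 0" and [measurable]: "u \<in> borel_measurable borel"
  shows "(\<integral>v. u v \<partial>log_gamma_measure \<alpha> n) =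
    log_gamma_const \<alpha> n * (\<integral>v. u v * log_gamma_kernel \<alpha> n v \<partial>lborel)"
proof -
  have "(\<integral>v. u v \<partial>log_gamma_measure \<alpha> n) =
      (\<integral>v. (log_gamma_const \<alpha> n * log_gamma_kernel \<alpha> n v) *\<^sub>R u v \<partial>lborel)"
    unfolding log_gamma_measure_def
    using log_gamma_const_pos[OF assms(1,2)] log_gamma_kernel_pos[of \<alpha> n]
    by (intro integral_density) (auto simp: less_imp_le)
  also have "\<dots> = (\<integral>v. log_gamma_const \<alpha> n * (u v * log_gamma_kernel \<alpha> n v) \<partial>lborel)"
    by (simp add: mult_ac)
  also have "\<dots> = log_gamma_const \<alpha> n * (\<integral>v. u v * log_gamma_kernel \<alpha> n v \<partial>lborel)"
    by simp
  finally show ?thesis .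
qed

text \<open>Dominated convergence. The factors \<open>u n\<close> vary with \<open>n\<close> because
  they will be products of distribution functions at stage \<open>n\<close>.\<close>

lemma integral_log_gamma_kernel_tendsto:
  fixes u :: "nat \<Rightarrow> real \<Rightarrow> real"
  assumes \<alpha>: "\<alpha> > 0" and [measurable]: "\<And>n. u n \<in> borel_measurable borel" "w \<in> borel_measurable borel"
    and lim: "\<And>v. (\<lambda>n. u n v) \<longlonglongrightarrow> w v" and bound: "\<And>n v. n > 0 \<Longrightarrow> \<bar>u n v\<bar> \<le> 1"
  shows "(\<lambda>n. \<integral>v. u n v * log_gamma_kernel \<alpha> n v \<partial>lborel) \<longlonglongrightarrow>
    (\<integral>v. w v * exp (- (\<alpha> * (v\<^sup>2 / 2))) \<partial>lborel)"
\<comment> \<open>The shift drops the index 0, where the kernel is constantly 1 and neither bound is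
  available.\<close>
proof (rule LIMSEQ_imp_Suc, rule integral_dominated_convergence)
  show "integrable lborel (\<lambda>v. exp (\<alpha> / 2) * exp (- (\<alpha> / 2 * \<bar>v\<bar>)))"
    using \<alpha> by (intro integrable_mult_right integrable_exp_neg_abs) auto
  show "AE v in lborel. (\<lambda>n. u (Suc n) v * log_gamma_kernel \<alpha> (Suc n) v)
      \<longlonglongrightarrow> w v * exp (- (\<alpha> * (v\<^sup>2 / 2)))"
    by (intro AE_I2 tendsto_mult lim[THEN LIMSEQ_Suc] log_gamma_kernel_tendsto[THEN LIMSEQ_Suc])
  show "AE v in lborel. norm (u (Suc n) v * log_gamma_kernel \<alpha> (Suc n) v) \<le>
      exp (\<alpha> / 2) * exp (- (\<alpha> / 2 * \<bar>v\<bar>))" for n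
  proof (rule AE_I2)
    fix v
    have "\<bar>u (Suc n) v\<bar> * log_gamma_kernel \<alpha> (Suc n) v \<le> 1 * (exp (\<alpha> / 2) * exp (- (\<alpha> / 2 * \<bar>v\<bar>)))"
      using \<alpha> log_gamma_kernel_pos[of \<alpha> "Suc n" v]
      by (intro mult_mono bound log_gamma_kernel_le) auto
    then show "norm (u (Suc n) v * log_gamma_kernel \<alpha> (Suc n) v) \<le>
      exp (\<alpha> / 2) * exp (- (\<alpha> / 2 * \<bar>v\<bar>))"
      using log_gamma_kernel_pos[of \<alpha> "Suc n" v] by (simp add: abs_mult)
  qed
qed measurable

text \<open>Total mass 1 makes the constant the reciprocal of the kernel integral; total mass 1 of
  \<open>gauss \<alpha>\<close> identifies the reciprocal of the limiting integral.\<close>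

lemma log_gamma_const_tendsto:
  assumes \<alpha>: "\<alpha> > 0"
  shows "log_gamma_const \<alpha> \<longlonglongrightarrow> sqrt (\<alpha> / (2 * pi))"
proof -
  let ?I = "\<lambda>n. \<integral>v. 1 * log_gamma_kernel \<alpha> n v \<partial>lborel"
  let ?L = "\<integral>v. 1 * exp (- (\<alpha> * (v\<^sup>2 / 2))) \<partial>lborel"
  have "1 = (\<integral>v. gauss \<alpha> v \<partial>lborel)" using \<alpha> by simp
  also have "\<dots> = sqrt (\<alpha> / (2 * pi)) * ?L" using \<alpha> by (simp add: gauss_eq)
  finally have L: "sqrt (\<alpha> / (2 * pi)) * ?L = 1" ..
  then have "?L \<noteq> 0" and inv: "inverse ?L = sqrt (\<alpha> / (2 * pi))"
    by (auto simp: inverse_unique mult.commute)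
  have "?I \<longlonglongrightarrow> ?L" by (rule integral_log_gamma_kernel_tendsto) (use \<alpha> in auto)
  then have "(\<lambda>n. inverse (?I n)) \<longlonglongrightarrow> inverse ?L" using \<open>?L \<noteq> 0\<close> by (rule tendsto_inverse)
  moreover have "\<forall>\<^sub>F n in sequentially. inverse (?I n) = log_gamma_const \<alpha> n"
    using eventually_gt_at_top[of 0]
  proof eventually_elim
    case (elim n)
    then interpret prob_space "log_gamma_measure \<alpha> n" using \<alpha> by (intro prob_space_log_gamma_measure)
    have "log_gamma_const \<alpha> n * ?I n = 1"
      using integral_log_gamma_measure[of \<alpha> n "\<lambda>_. 1"] \<alpha> elim prob_space by simp
    then show ?case by (simp add: inverse_unique mult.commute)
  qed
  ultimately show ?thesis unfolding inv by (rule Lim_transform_eventually)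
qed

text \<open>Used twice: for indicators of half-lines it gives the convergence of distribution
  functions, for products of these functions the limit of \<open>tau1\<close>.\<close>

lemma integral_log_gamma_measure_tendsto:
  fixes u :: "nat \<Rightarrow> real \<Rightarrow> real"
  assumes \<alpha>: "\<alpha> > 0" and [measurable]: "\<And>n. u n \<in> borel_measurable borel" "w \<in> borel_measurable borel"
    and lim: "\<And>v. (\<lambda>n. u n v) \<longlonglongrightarrow> w v" and bound: "\<And>n v. n > 0 \<Longrightarrow> \<bar>u n v\<bar> \<le> 1"
  shows "(\<lambda>n. \<integral>v. u n v \<partial>log_gamma_measure \<alpha> n) \<longlonglongrightarrow> (\<integral>v. w v * gauss \<alpha> v \<partial>lborel)"
proof -
  have "(\<lambda>n. log_gamma_const \<alpha> n * (\<integral>v. u n v * log_gamma_kernel \<alpha> n v \<partial>lborel)) \<longlonglongrightarrow>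
      sqrt (\<alpha> / (2 * pi)) * (\<integral>v. w v * exp (- (\<alpha> * (v\<^sup>2 / 2))) \<partial>lborel)"
    by (intro tendsto_mult log_gamma_const_tendsto integral_log_gamma_kernel_tendsto assms)
  also have "sqrt (\<alpha> / (2 * pi)) * (\<integral>v. w v * exp (- (\<alpha> * (v\<^sup>2 / 2))) \<partial>lborel) = (\<integral>v. w v * gauss \<alpha> v \<partial>lborel)"
    unfolding gauss_eq[OF \<alpha>] by (subst mult.left_commute) simp
  finally show ?thesis
    by (rule Lim_transform_eventually)
       (use eventually_gt_at_top[of 0] in eventually_elim, simp add: integral_log_gamma_measure \<alpha>)
qed

lemma cdf_log_gamma_measure_tendsto:
  assumes "\<alpha> > 0"
  shows "(\<lambda>n. measure (log_gamma_measure \<alpha> n) {..u}) \<longlonglongrightarrow> gauss_cdf \<alpha> u"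
proof -
  have "(\<lambda>n. \<integral>v. indicator {..u} v \<partial>log_gamma_measure \<alpha> n) \<longlonglongrightarrow> gauss_cdf \<alpha> u"
    unfolding gauss_cdf_def using assms
    by (intro integral_log_gamma_measure_tendsto) (auto simp: indicator_def)
  then show ?thesis by simp
qed

section \<open>The limit of the probabilities\<close>

lemma cdf_measurable:
  fixes M :: "real measure"
  assumes "prob_space M" and [simp]: "sets M = sets borel"
  shows "(\<lambda>y. measure M {..y}) \<in> borel_measurable borel"
proof -
  interpret prob_space M by fact
  have "mono (\<lambda>y. measure M {..y})" by (auto intro!: monoI finite_measure_mono)
  then show ?thesis by (rule borel_measurable_mono)
qed

text \<open>Conditioning on coordinate \<open>i\<close>: given \<open>G i = y\<close>, the event is
  a box of half-lines, whose product measure factorises.\<close>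

lemma measure_PiM_all_le:
  fixes M :: "'i \<Rightarrow> real measure" and c :: "'i \<Rightarrow> real"
  assumes ps: "\<And>j. prob_space (M j)" and sets: "\<And>j. sets (M j) = sets borel"
    and I: "finite I" "i \<notin> I"
  shows "measure (PiM (insert i I) M) {G \<in> space (PiM (insert i I) M). \<forall>k\<in>I. G k \<le> c k * G i} =
    (\<integral>y. (\<Prod>k\<in>I. measure (M k) {..c k * y}) \<partial>M i)"
proof -
  interpret product_prob_space M
    using ps by (intro product_prob_spaceI)
  note sets [measurable_cong]
  have sp: "space (M j) = UNIV" for j using sets_eq_imp_space_eq[OF sets[of j]] by simp
  let ?P = "PiM (insert i I) M"
  let ?S = "{G \<in> space ?P. \<forall>k\<in>I. G k \<le> c k * G i}"
  have [measurable]: "(\<lambda>G. G k) \<in> borel_measurable ?P" if "k \<in> insert i I" for k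
    using measurable_component_singleton[OF that, of M] measurable_cong_sets[OF refl sets] by blast
  have S: "?S \<in> sets ?P"
    using I by (intro sets.sets_Collect_finite_All borel_measurable_le borel_measurable_times) auto
  have cdf: "(\<lambda>y. measure (M k) {..c k * y}) \<in> borel_measurable borel" for k
  proof -
    have [measurable]: "(\<lambda>y. measure (M k) {..y}) \<in> borel_measurable borel"
      by (intro cdf_measurable ps sets)
    show ?thesis by measurable
  qed
  have "emeasure ?P ?S = (\<integral>\<^sup>+G. indicator ?S G \<partial>?P)" using S by simp
  also have "\<dots> = (\<integral>\<^sup>+y. (\<integral>\<^sup>+G. indicator ?S (G(i := y)) \<partial>PiM I M) \<partial>M i)"
    using I S by (intro product_nn_integral_insert_rev) auto
  also have "\<dots> = (\<integral>\<^sup>+y. (\<integral>\<^sup>+G. indicator (\<Pi>\<^sub>E k\<in>I. {..c k * y}) G \<partial>PiM I M) \<partial>M i)"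
    using I by (intro nn_integral_cong)
      (auto simp: indicator_def space_PiM PiE_iff sp extensional_def)
  also have "\<dots> = (\<integral>\<^sup>+y. ennreal (\<Prod>k\<in>I. measure (M k) {..c k * y}) \<partial>M i)"
  proof (rule nn_integral_cong)
    fix y
    have "(\<integral>\<^sup>+G. indicator (\<Pi>\<^sub>E k\<in>I. {..c k * y}) G \<partial>PiM I M) = emeasure (PiM I M) (\<Pi>\<^sub>E k\<in>I. {..c k * y})"
      using I by (intro nn_integral_indicator sets_PiM_I_finite) (auto simp: sets)
    also have "\<dots> = (\<Prod>k\<in>I. emeasure (M k) {..c k * y})"
      using I by (intro emeasure_PiM) (auto simp: sets)
    also have "\<dots> = ennreal (\<Prod>k\<in>I. measure (M k) {..c k * y})"
      by (simp add: M.emeasure_eq_measure prod_ennreal)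
    finally show "(\<integral>\<^sup>+G. indicator (\<Pi>\<^sub>E k\<in>I. {..c k * y}) G \<partial>PiM I M) =
      ennreal (\<Prod>k\<in>I. measure (M k) {..c k * y})" .
  qed
  also have "\<dots> = ennreal (\<integral>y. (\<Prod>k\<in>I. measure (M k) {..c k * y}) \<partial>M i)"
  proof (intro nn_integral_eq_integral)
    have "(\<lambda>y. \<Prod>k\<in>I. measure (M k) {..c k * y}) \<in> borel_measurable (M i)"
      using cdf by (subst measurable_cong_sets[OF sets refl]) (rule borel_measurable_prod)
    then show "integrable (M i) (\<lambda>y. \<Prod>k\<in>I. measure (M k) {..c k * y})"
      by (intro M.integrable_const_bound[where B = 1] AE_I2)
         (simp_all add: abs_prod prod_le_1 M.prob_le_1)
  qed (intro AE_I2 prod_nonneg, simp)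
  finally have eq: "emeasure ?P ?S = \<dots>" .
  show ?thesis
    unfolding measure_def[of ?P] eq
    by (intro enn2real_ennreal Bochner_Integration.integral_nonneg prod_nonneg) simp
qed

text \<open>Writing \<open>G j = \<alpha> j * n * exp (V j / sqrt n)\<close> turns the event into
  \<open>V k \<le> V 1\<close> for all \<open>k\<close>; conditioning on \<open>V 1 = u\<close>
  leaves a product of distribution functions.\<close>

lemma tau1_eq_integral_log_gamma:
  assumes m: "m \<ge> 1" and \<alpha>: "\<forall>j\<in>{1..m}. \<alpha> j > 0" and n: "n > 0"
  shows "tau1 m (\<lambda>j. \<alpha> j * real n) =
    (\<integral>u. (\<Prod>k\<in>{2..m}. measure (log_gamma_measure (\<alpha> k) n) {..u}) \<partial>log_gamma_measure (\<alpha> 1) n)"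
proof -
  \<comment> \<open>The value 1 off \<open>{1..m}\<close> is a dummy:
    \<open>measure_PiM_all_le\<close> asks for a probability measure at every index, while
    \<open>\<alpha>\<close> is known to be positive only on \<open>{1..m}\<close>.\<close>
  define M where "M j = gamma_measure (if j \<in> {1..m} then \<alpha> j * real n else 1)" for j
  let ?c = "\<lambda>k. (\<alpha> k * real n) / (\<alpha> 1 * real n)"
  have \<alpha>1: "\<alpha> 1 > 0" using m \<alpha> by simp
  have ins: "{1..m} = insert 1 {2..m}" using m by auto
  have PM: "PiM {1..m} (\<lambda>j. gamma_measure (\<alpha> j * real n)) = PiM (insert 1 {2..m}) M"
    unfolding ins by (intro PiM_cong) (use m in \<open>auto simp: M_def\<close>)
  have ps: "prob_space (M j)" for j
    unfolding M_def using \<alpha> n by (intro prob_space_gamma_measure) auto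
  have "tau1 m (\<lambda>j. \<alpha> j * real n) = measure (PiM (insert 1 {2..m}) M)
      {G \<in> space (PiM (insert 1 {2..m}) M). \<forall>k\<in>{2..m}. G k \<le> ?c k * G 1}"
    unfolding tau1_def Let_def PM using n \<alpha> \<alpha>1
    by (intro arg_cong[where f = "measure _"] Collect_cong conj_cong ball_cong refl)
       (auto simp: field_simps)
  also have "\<dots> = (\<integral>y. (\<Prod>k\<in>{2..m}. measure (M k) {..?c k * y}) \<partial>M 1)"
    by (intro measure_PiM_all_le ps) (auto simp: M_def)
  also have "\<dots> = (\<integral>y. (\<Prod>k\<in>{2..m}. measure (M k) {..?c k * y})
      \<partial>distr (log_gamma_measure (\<alpha> 1) n) borel (\<lambda>v. \<alpha> 1 * real n * exp (v / sqrt (real n))))"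
    using m \<alpha>1 n by (simp add: M_def gamma_measure_eq_distr_log_gamma)
  also have "\<dots> = (\<integral>u. (\<Prod>k\<in>{2..m}. measure (M k) {..?c k * (\<alpha> 1 * real n * exp (u / sqrt (real n)))})
      \<partial>log_gamma_measure (\<alpha> 1) n)"
  proof (rule integral_distr)
    show "(\<lambda>y. \<Prod>k\<in>{2..m}. measure (M k) {..?c k * y}) \<in> borel_measurable borel"
    proof (rule borel_measurable_prod)
      fix k
      have [measurable]: "(\<lambda>y. measure (M k) {..y}) \<in> borel_measurable borel"
        by (intro cdf_measurable ps) (simp add: M_def)
      show "(\<lambda>y. measure (M k) {..?c k * y}) \<in> borel_measurable borel" by measurable
    qed
  qed measurable
  also have "\<dots> = (\<integral>u. (\<Prod>k\<in>{2..m}. measure (log_gamma_measure (\<alpha> k) n) {..u}) \<partial>log_gamma_measure (\<alpha> 1) n)"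
  proof (intro Bochner_Integration.integral_cong prod.cong refl)
    fix u k assume k: "k \<in> {2..m}"
    then have \<alpha>k: "\<alpha> k > 0" using \<alpha> by simp
    have "measure (M k) {..?c k * (\<alpha> 1 * real n * exp (u / sqrt (real n)))} =
      measure (distr (log_gamma_measure (\<alpha> k) n) borel (\<lambda>v. \<alpha> k * real n * exp (v / sqrt (real n))))
        {..\<alpha> k * real n * exp (u / sqrt (real n))}"
    proof -
      have "M k = distr (log_gamma_measure (\<alpha> k) n) borel (\<lambda>v. \<alpha> k * real n * exp (v / sqrt (real n)))"
        using k \<alpha>k n by (simp add: M_def gamma_measure_eq_distr_log_gamma)
      moreover have "?c k * (\<alpha> 1 * real n * exp (u / sqrt (real n))) = \<alpha> k * real n * exp (u / sqrt (real n))"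
        using \<alpha>1 n by simp
      ultimately show ?thesis by (simp only:)
    qed
    \<comment> \<open>The substitution is strictly increasing, so the half-line pulls back to
      \<open>{..u}\<close>.\<close>
    also have "\<dots> = measure (log_gamma_measure (\<alpha> k) n) {..u}"
      using \<alpha>k n by (subst measure_distr) (auto intro!: arg_cong[where f = "measure _"] simp: divide_le_cancel)
    finally show "measure (M k) {..?c k * (\<alpha> 1 * real n * exp (u / sqrt (real n)))} =
      measure (log_gamma_measure (\<alpha> k) n) {..u}" .
  qed
  finally show ?thesis .
qed

text \<open>The inner distribution functions converge pointwise and are bounded by 1, so they and
  the outer measure pass to the limit together.\<close>

lemma tau1_tendsto:
  assumes m: "m \<ge> 1" and \<alpha>: "\<forall>j\<in>{1..m}. \<alpha> j > 0"
  shows "(\<lambda>n. tau1 m (\<lambda>j. \<alpha> j * real n)) \<longlonglongrightarrow>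
    (\<integral>u. (\<Prod>k\<in>{2..m}. gauss_cdf (\<alpha> k) u) * gauss (\<alpha> 1) u \<partial>lborel)"
proof -
  \<comment> \<open>At \<open>n = 0\<close> the constant is junk, so \<^const>\<open>log_gamma_measure\<close> need not be a probability measure.\<close>
  let ?u = "\<lambda>n u. if n = 0 then 0 else (\<Prod>k\<in>{2..m}. measure (log_gamma_measure (\<alpha> k) n) {..u})"
  have "(\<lambda>n. \<integral>u. ?u n u \<partial>log_gamma_measure (\<alpha> 1) n) \<longlonglongrightarrow>
    (\<integral>u. (\<Prod>k\<in>{2..m}. gauss_cdf (\<alpha> k) u) * gauss (\<alpha> 1) u \<partial>lborel)"
  proof (rule integral_log_gamma_measure_tendsto)
    show "\<alpha> 1 > 0" using m \<alpha> by simp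
    show "?u n \<in> borel_measurable borel" for n
    proof (cases "n = 0")
      case False
      then show ?thesis using \<alpha>
        by (auto intro!: borel_measurable_prod cdf_measurable prob_space_log_gamma_measure)
    qed simp
    show "(\<lambda>u. \<Prod>k\<in>{2..m}. gauss_cdf (\<alpha> k) u) \<in> borel_measurable borel"
      using \<alpha> by (intro borel_measurable_prod gauss_cdf_measurable) auto
    show "(\<lambda>n. ?u n v) \<longlonglongrightarrow> (\<Prod>k\<in>{2..m}. gauss_cdf (\<alpha> k) v)" for v
    proof (rule Lim_transform_eventually)
      show "(\<lambda>n. \<Prod>k\<in>{2..m}. measure (log_gamma_measure (\<alpha> k) n) {..v})
          \<longlonglongrightarrow> (\<Prod>k\<in>{2..m}. gauss_cdf (\<alpha> k) v)"
        using \<alpha> by (intro tendsto_prod cdf_log_gamma_measure_tendsto) auto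
    qed (use eventually_gt_at_top[of 0] in eventually_elim, simp)
    show "\<bar>?u n v\<bar> \<le> 1" if "n > 0" for n v
      using that \<alpha> by (auto simp: abs_prod intro!: prod_le_1 prob_space.prob_le_1 prob_space_log_gamma_measure)
  qed
  then show ?thesis
    by (rule Lim_transform_eventually)
       (use eventually_gt_at_top[of 0] in eventually_elim, simp add: tau1_eq_integral_log_gamma[OF m \<alpha>])
qed

section \<open>Consequences for \<open>T\<close>\<close>

text \<open>Substituting \<open>u = z / sqrt (\<alpha> 1)\<close> and using
  \<open>gauss_cdf_scale\<close> gives the usual form, with factors Phi at
  \<open>sqrt (\<alpha> k / \<alpha> 1) * z\<close> and the standard normal density.\<close>

lemma T_eq_integral:
  assumes "m \<ge> 1" "\<forall>j\<in>{1..m}. \<alpha> j > 0"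
  shows "T m \<alpha> = (\<integral>u. (\<Prod>k\<in>{2..m}. gauss_cdf (\<alpha> k) u) * gauss (\<alpha> 1) u \<partial>lborel)"
  unfolding T_def by (rule limI[OF tau1_tendsto[OF assms]])

lemma T_strict_mono_on:
  assumes m: "m \<ge> 3" and \<alpha>: "\<forall>j\<in>{1..m}. \<alpha> j > 0" and l: "l \<in> {2..m}"
  shows "strict_mono_on {0<..} (\<lambda>a. T m (\<alpha>(l := a)))"
proof (rule strict_mono_onI)
  fix a b :: real assume ab: "a \<in> {0<..}" "b \<in> {0<..}" "a < b"
  let ?K = "{2..m} - {l}"
  have T_eq: "T m (\<alpha>(l := c)) =
      (\<integral>u. gauss_cdf c u * (\<Prod>k\<in>?K. gauss_cdf (\<alpha> k) u) * gauss (\<alpha> 1) u \<partial>lborel)"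
    if "c > 0" for c
  proof -
    have "(\<Prod>k\<in>{2..m}. gauss_cdf ((\<alpha>(l := c)) k) u) = gauss_cdf c u * (\<Prod>k\<in>?K. gauss_cdf (\<alpha> k) u)" for u
      using l by (subst prod.remove[of _ l]) (auto intro!: prod.cong)
    moreover have "(\<alpha>(l := c)) 1 = \<alpha> 1" using l by simp
    ultimately show ?thesis
      using m \<alpha> that by (subst T_eq_integral) (auto simp: fun_upd_def)
  qed
  \<comment> \<open>As \<open>m \<ge> 3\<close>, there is a player other than 1 and
    \<open>l\<close>: one of 2 and 3 differs from \<open>l\<close>.\<close>
  have "(if l = 2 then 3 else 2) \<in> ?K" using m by auto
  then have "?K \<noteq> {}" by blast
  moreover have "\<alpha> 1 > 0" "\<And>k. k \<in> ?K \<Longrightarrow> \<alpha> k > 0" using m \<alpha> by auto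
  ultimately show "T m (\<alpha>(l := a)) < T m (\<alpha>(l := b))"
    using ab by (simp only: T_eq greaterThan_iff) (intro gauss_cdf_product_integral_strict_mono; simp)
qed

text \<open>Convergence is asserted separately because \<open>lim\<close>, and hence
  \<open>T\<close>, would carry no information on a divergent sequence. It applies to
  \<open>\<alpha>(l := a)\<close> as well, which is again positive for \<open>a > 0\<close>.\<close>

theorem mainTheorem11:
  fixes m :: nat and \<alpha> :: "nat \<Rightarrow> real"
  assumes "m \<ge> 2"
    and "\<forall>j\<in>{1..m}. \<alpha> j > 0"
  shows "convergent (\<lambda>n. tau1 m (\<lambda>j. \<alpha> j * real n)) \<and>
         (m \<ge> 3 \<longrightarrow> (\<forall>l\<in>{2..m}. strict_mono_on {0<..} (\<lambda>a. T m (\<alpha>(l := a))))) \<and>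
         (m = 2 \<longrightarrow> T m \<alpha> = 1 / 2)"
proof (intro conjI impI ballI)
  have m: "m \<ge> 1" using assms(1) by simp
  show "convergent (\<lambda>n. tau1 m (\<lambda>j. \<alpha> j * real n))"
    by (rule convergentI[OF tau1_tendsto[OF m assms(2)]])
  show "strict_mono_on {0<..} (\<lambda>a. T m (\<alpha>(l := a)))" if "m \<ge> 3" "l \<in> {2..m}" for l
    by (rule T_strict_mono_on[OF that(1) assms(2) that(2)])
  show "T m \<alpha> = 1 / 2" if "m = 2"
    unfolding T_eq_integral[OF m assms(2)] using that assms(2) by (simp add: gauss_cdf_integral_half)
qed

end
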